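(* Let $f\in\Gamma_0(\mathbb{R}^n)$ and $r>0$. Then $f$ is essentially strictly convex if and only if $e_rf$ is strictly convex.
   Context: $\Gamma_0(\mathbb{R}^n)$ is the set of proper, convex, lower semicontinuous functions $f:\mathbb{R}^n\to\mathbb{R}\cup\{\infty\}$. $\|\cdot\|$ is the Euclidean norm, and the Moreau envelope is $e_rf(x)=\inf_{y\in\mathbb{R}^n}\{f(y)+\frac r2\|y-x\|^2\}$. A function $f\in\Gamma_0(\mathbb{R}^n)$ is strictly convex if $f(\lambda x+(1-\lambda)y)<\lambda f(x)+(1-\lambda)f(y)$ for all $x\ne y$ in $\operatorname{dom} f$ and all $\lambda\in(0,1)$. It is essentially strictly convex if it is strictly convex on every convex subset of $\operatorname{dom}\partial f=\{x:\partial f(x)\neq\varnothing\}$, where $\partial f$ is the convex subdifferential. *)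

theory Defs
  imports "HOL-Analysis.Analysis"
begin

definition edom :: "('a \<Rightarrow> ereal) \<Rightarrow> 'a set" where
  "edom f = {x. f x < \<infinity>}"

definition proper :: "('a \<Rightarrow> ereal) \<Rightarrow> bool" where
  "proper f \<longleftrightarrow> (\<forall>x. f x \<noteq> -\<infinity>) \<and> edom f \<noteq> {}"

(* Applied only to functions that avoid the value -\<infinity>, so the right-hand side never
   involves \<infinity> - \<infinity>. *)
definition econvex :: "('a::real_vector \<Rightarrow> ereal) \<Rightarrow> bool" where
  "econvex f \<longleftrightarrow>
    (\<forall>x y. \<forall>t\<in>{0<..<1::real}.
      f (t *\<^sub>R x + (1 - t) *\<^sub>R y) \<le> ereal t * f x + ereal (1 - t) * f y)"

definition lsc :: "('a::topological_space \<Rightarrow> ereal) \<Rightarrow> bool" where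
  "lsc f \<longleftrightarrow> (\<forall>x. f x \<le> Liminf (at x) f)"

definition Gamma0 :: "('a::real_normed_vector \<Rightarrow> ereal) set" where
  "Gamma0 = {f. proper f \<and> econvex f \<and> lsc f}"

definition strictly_convex_on :: "'a::real_vector set \<Rightarrow> ('a \<Rightarrow> ereal) \<Rightarrow> bool" where
  "strictly_convex_on C f \<longleftrightarrow>
    (\<forall>x\<in>C. \<forall>y\<in>C. x \<noteq> y \<longrightarrow> (\<forall>t\<in>{0<..<1::real}.
      f (t *\<^sub>R x + (1 - t) *\<^sub>R y) < ereal t * f x + ereal (1 - t) * f y))"

definition strictly_convex :: "('a::real_vector \<Rightarrow> ereal) \<Rightarrow> bool" where
  "strictly_convex f \<longleftrightarrow> strictly_convex_on (edom f) f"

(* For proper f this is empty outside edom f, as the inequality fails at a point of edom f. *)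
definition subdifferential :: "('a::real_inner \<Rightarrow> ereal) \<Rightarrow> 'a \<Rightarrow> 'a set" where
  "subdifferential f x = {v. \<forall>y. f y \<ge> f x + ereal (v \<bullet> (y - x))}"

definition dom_subdifferential :: "('a::real_inner \<Rightarrow> ereal) \<Rightarrow> 'a set" where
  "dom_subdifferential f = {x. subdifferential f x \<noteq> {}}"

definition essentially_strictly_convex :: "('a::real_inner \<Rightarrow> ereal) \<Rightarrow> bool" where
  "essentially_strictly_convex f \<longleftrightarrow>
    (\<forall>C. convex C \<and> C \<subseteq> dom_subdifferential f \<longrightarrow> strictly_convex_on C f)"

definition moreau_envelope :: "real \<Rightarrow> ('a::real_normed_vector \<Rightarrow> ereal) \<Rightarrow> 'a \<Rightarrow> ereal" where
  "moreau_envelope r f x = (INF y. f y + ereal (r / 2 * (norm (y - x))\<^sup>2))"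

end

(* A proximal point p of x attains the infimum in the envelope at x, and then r (x - p) is a
   subgradient of f at p; conversely, if v is a subgradient at p, then p is a proximal point of
   p + v / r.  Equality in the convexity inequality of the envelope at x and y forces x - p = y - q
   for the proximal points p and q, i.e. a common subgradient at p and q.  It remains a subgradient
   on the segment between p and q, where f is then affine.  In the other direction, if f fails to be
   strictly convex along a segment in the domain of the subdifferential, a subgradient v at an inner
   point is a subgradient at both ends, and the envelope fails to be strictly convex along the
   translate of the segment by v / r. *)
theory Submission
  imports Defs
begin

section \<open>Lower semicontinuity and attained minima\<close>

lemma open_superlevel_lsc:
  fixes f :: "'a::topological_space \<Rightarrow> ereal"
  assumes "lsc f"
  shows "open {z. c < f z}"
proof (subst open_subopen, intro ballI)
  fix x assume "x \<in> {z. c < f z}"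
  then have x: "c < f x" by simp
  then have "c < Liminf (at x) f"
    using assms unfolding lsc_def by (meson less_le_trans)
  then have "eventually (\<lambda>z. c < f z) (at x)"
    by (rule less_LiminfD)
  \<comment> \<open>\<open>at x\<close> is the punctured filter; the point \<open>x\<close> itself
    is supplied by \<open>c < f x\<close>.\<close>
  then have "eventually (\<lambda>z. c < f z) (nhds x)"
    unfolding eventually_at_filter by (rule eventually_mono) (use x in auto)
  then show "\<exists>T. open T \<and> x \<in> T \<and> T \<subseteq> {z. c < f z}"
    unfolding eventually_nhds by auto
qed

lemma open_superlevel_lsc_plus_continuous:
  fixes f :: "'a::topological_space \<Rightarrow> ereal" and h :: "'a \<Rightarrow> real"
  assumes "lsc f" and "continuous_on UNIV h"
  shows "open {z. c < f z + ereal (h z)}"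
proof -
  \<comment> \<open>A real level \<open>d\<close> strictly below \<open>f z\<close> separates the
    two summands, so the superlevel set of the sum becomes a union of intersections of open
    sets.\<close>
  have "c < f z + ereal (h z) \<longleftrightarrow> (\<exists>d. ereal d < f z \<and> c < ereal (d + h z))" for z
  proof
    assume "c < f z + ereal (h z)"
    then have "c - ereal (h z) < f z"
      by (cases c; cases "f z") auto
    then obtain d where "c - ereal (h z) < ereal d" "ereal d < f z"
      using ereal_dense2 by blast
    then show "\<exists>d. ereal d < f z \<and> c < ereal (d + h z)"
      by (intro exI[of _ d]) (cases c; auto)
  next
    assume "\<exists>d. ereal d < f z \<and> c < ereal (d + h z)"
    then show "c < f z + ereal (h z)"
      by (cases c; cases "f z") auto
  qed
  then have "{z. c < f z + ereal (h z)} = (\<Union>d. {z. ereal d < f z} \<inter> {z. c < ereal (d + h z)})"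
    by auto
  moreover have "open {z. c < ereal (d + h z)}" for d
    by (intro open_Collect_less continuous_intros assms)
  ultimately show ?thesis
    using open_superlevel_lsc[OF assms(1)] by (auto intro!: open_UN open_Int)
qed

text \<open>If no minimum were attained, the open sets \<open>{z. g y < g z}\<close> with
  \<open>y\<close> in \<open>K\<close> would cover \<open>K\<close>. In a finite subcover, an index
  with the smallest value lies in none of the chosen sets.\<close>

lemma compact_attains_inf_open_superlevel:
  fixes g :: "'a::topological_space \<Rightarrow> 'b::linorder"
  assumes "compact K" and "K \<noteq> {}" and op: "\<And>c. open {z. c < g z}"
  shows "\<exists>x\<in>K. \<forall>y\<in>K. g x \<le> g y"
proof (rule ccontr)
  assume "\<not> ?thesis"
  then have "K \<subseteq> (\<Union>y\<in>K. {z. g y < g z})" by (auto simp: not_le)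
  then obtain Y where Y: "Y \<subseteq> K" "finite Y" "K \<subseteq> (\<Union>y\<in>Y. {z. g y < g z})"
    using compactE_image[OF assms(1), of K "\<lambda>y. {z. g y < g z}"] op by blast
  then have "Y \<noteq> {}" using assms(2) by auto
  then obtain y where "y \<in> Y" "\<forall>y'\<in>Y. g y \<le> g y'"
    using Y(2) finite_has_minimal[of "g ` Y"] by (metis arg_min_if_finite not_le)
  then show False using Y by fastforce
qed

section \<open>Growth bound and existence of proximal points\<close>

text \<open>On the unit ball around a point of finite value, \<open>f\<close> attains a minimum;
  convexity along rays from the centre spreads this bound outwards at a linear rate. A quadratic
  term can then dominate any decrease of \<open>f\<close>.\<close>

lemma Gamma0_lower_bound:
  fixes f :: "'a::euclidean_space \<Rightarrow> ereal"
  assumes "f \<in> Gamma0"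
  obtains x0 a K where "f x0 = ereal a" "\<And>y. ereal (- K * (1 + norm (y - x0))) \<le> f y"
proof -
  have ninf: "\<And>x. f x \<noteq> -\<infinity>" and cvx: "econvex f" and l: "lsc f"
    using assms by (auto simp: Gamma0_def proper_def)
  obtain x0 where "f x0 < \<infinity>"
    using assms by (auto simp: Gamma0_def proper_def edom_def)
  then obtain a where a: "f x0 = ereal a"
    using ninf[of x0] by (cases "f x0") auto
  obtain x1 where x1: "\<And>y. y \<in> cball x0 1 \<Longrightarrow> f x1 \<le> f y"
    using compact_attains_inf_open_superlevel[of "cball x0 1" f] open_superlevel_lsc[OF l]
    by (metis centre_in_cball compact_cball empty_iff zero_le_one)
  have "f x1 \<noteq> \<infinity>" using x1[of x0] a by auto
  then obtain b where b: "f x1 = ereal b" using ninf[of x1] by (cases "f x1") auto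
  define K where "K = \<bar>a\<bar> + \<bar>b\<bar>"
  have "ereal (- K * (1 + norm (y - x0))) \<le> f y" for y
  proof (cases "norm (y - x0) \<le> 1")
    case True
    have "0 \<le> K * norm (y - x0)" by (simp add: K_def)
    moreover have "- K * (1 + norm (y - x0)) = - K - K * norm (y - x0)"
      by (simp add: algebra_simps)
    moreover have "- K \<le> b" by (simp add: K_def)
    ultimately have "- K * (1 + norm (y - x0)) \<le> b" by linarith
    moreover have "ereal b \<le> f y"
      using x1[of y] True b by (simp add: dist_norm norm_minus_commute)
    ultimately show ?thesis by (meson ereal_less_eq(3) order_trans)
  next
    case False
    define n where "n = norm (y - x0)"
    define s where "s = 1 / n"
    have n: "n > 1" using False by (simp add: n_def)
    then have s: "s \<in> {0<..<1}" by (simp add: s_def)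
    \<comment> \<open>The point where the segment from \<open>x0\<close> to \<open>y\<close> crosses
      the unit sphere around \<open>x0\<close>, so \<open>f z\<close> is at least the ball minimum
      \<open>b\<close>.\<close>
    define z where "z = s *\<^sub>R y + (1 - s) *\<^sub>R x0"
    have "z - x0 = s *\<^sub>R (y - x0)" by (simp add: z_def algebra_simps)
    then have "norm (z - x0) = 1" using n by (simp add: s_def n_def[symmetric])
    then have "ereal b \<le> f z"
      using x1[of z] b by (simp add: dist_norm norm_minus_commute)
    also have "f z \<le> ereal s * f y + ereal (1 - s) * f x0"
      using cvx s unfolding econvex_def z_def by blast
    finally have le: "ereal b \<le> ereal s * f y + ereal (1 - s) * ereal a" by (simp add: a)
    show ?thesis
    proof (cases "f y")
      case (real c)
      then have "b \<le> s * c + (1 - s) * a" using le by simp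
      \<comment> \<open>Multiplying by \<open>n = 1 / s\<close> isolates \<open>c\<close>, the value
        of \<open>f\<close> at \<open>y\<close>.\<close>
      then have "n * b \<le> n * (s * c + (1 - s) * a)" using n by (intro mult_left_mono) auto
      also have "\<dots> = c + (n - 1) * a" using n by (simp add: s_def field_simps)
      also have "(n - 1) * a \<le> (n - 1) * \<bar>a\<bar>"
        using n by (intro mult_left_mono) auto
      also have "(n - 1) * \<bar>a\<bar> \<le> n * \<bar>a\<bar>"
        by (intro mult_right_mono) auto
      finally have "n * b \<le> c + n * \<bar>a\<bar>" by simp
      moreover have "n * (- b) \<le> n * \<bar>b\<bar>"
        using n by (intro mult_left_mono) auto
      ultimately have "- (n * \<bar>a\<bar> + n * \<bar>b\<bar>) \<le> c" by simp
      moreover have "n * K = n * \<bar>a\<bar> + n * \<bar>b\<bar>" "0 \<le> K" by (simp_all add: K_def algebra_simps)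
      ultimately show ?thesis
        unfolding n_def[symmetric] real distrib_left by (simp add: mult.commute)
    qed (use ninf in auto)
  qed
  with a show ?thesis by (rule that)
qed

text \<open>A relation rather than an operator: a proximal point may come from compactness or be
  read off from a subgradient.\<close>

definition is_prox :: "real \<Rightarrow> ('a::real_normed_vector \<Rightarrow> ereal) \<Rightarrow> 'a \<Rightarrow> 'a \<Rightarrow> bool" where
  "is_prox r f x p \<longleftrightarrow>
    (\<forall>y. f p + ereal (r / 2 * (norm (p - x))\<^sup>2) \<le> f y + ereal (r / 2 * (norm (y - x))\<^sup>2))"

lemma moreau_envelope_eq:
  assumes "is_prox r f x p"
  shows "moreau_envelope r f x = f p + ereal (r / 2 * (norm (p - x))\<^sup>2)"
  unfolding moreau_envelope_def
  by (rule antisym[OF INF_lower INF_greatest]) (use assms in \<open>auto simp: is_prox_def\<close>)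

lemma is_prox_exists:
  fixes f :: "'a::euclidean_space \<Rightarrow> ereal"
  assumes "f \<in> Gamma0" and "r > 0"
  obtains p a where "is_prox r f x p" "f p = ereal a"
proof -
  obtain x0 a K where a: "f x0 = ereal a" and lb: "\<And>y. ereal (- K * (1 + norm (y - x0))) \<le> f y"
    using Gamma0_lower_bound[OF assms(1)] by metis
  define h where "h = (\<lambda>y. r / 2 * (norm (y - x))\<^sup>2)"
  define g where "g = (\<lambda>y. f y + ereal (h y))"
  \<comment> \<open>\<open>A\<close> is the objective at \<open>x0\<close>, the value to beat.
    \<open>R\<close> is large enough that outside the ball the distance \<open>n\<close> to
    \<open>x\<close> exceeds 1 and \<open>r / 2 * n\<close> exceeds
    \<open>B + \<bar>K\<bar>\<close>; the quadratic term then outweighs the linear lower bound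
    together with \<open>A\<close>.\<close>
  define A where "A = a + h x0"
  define B where "B = \<bar>A\<bar> + \<bar>K\<bar> * (1 + norm (x - x0))"
  define R where "R = 1 + norm (x0 - x) + 2 / r * (B + \<bar>K\<bar>)"
  have B0: "B \<ge> 0" by (simp add: B_def)
  have far: "ereal A < g y" if y: "norm (y - x) > R" for y
  proof -
    let ?n = "norm (y - x)"
    have R1: "?n > 1" and R2: "r / 2 * ?n > B + \<bar>K\<bar>"
    proof -
      have "2 / r * (B + \<bar>K\<bar>) \<ge> 0" using assms(2) B0 by simp
      then show "?n > 1" using y norm_ge_zero[of "x0 - x"] unfolding R_def by linarith
      have "?n > 2 / r * (B + \<bar>K\<bar>)" using y norm_ge_zero[of "x0 - x"] unfolding R_def by linarith
      then show "r / 2 * ?n > B + \<bar>K\<bar>" using assms(2) by (simp add: field_simps)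
    qed
    have "norm (y - x0) \<le> ?n + norm (x - x0)"
      using norm_triangle_ineq[of "y - x" "x - x0"] by simp
    then have "K * (1 + norm (y - x0)) \<le> \<bar>K\<bar> * (1 + (?n + norm (x - x0)))"
      by (intro mult_mono) auto
    also have "\<dots> = B - \<bar>A\<bar> + \<bar>K\<bar> * ?n" by (simp add: B_def algebra_simps)
    \<comment> \<open>Here \<open>?n > 1\<close> lets the constant \<open>B\<close> be absorbed into
      a multiple of \<open>?n\<close>.\<close>
    also have "\<dots> \<le> (B + \<bar>K\<bar>) * ?n - \<bar>A\<bar>"
      using mult_left_mono[of 1 ?n B] R1 B0 by (simp add: algebra_simps)
    also have "\<dots> < r / 2 * ?n * ?n - \<bar>A\<bar>"
      using mult_strict_right_mono[OF R2, of ?n] R1 by linarith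
    finally have "A < - K * (1 + norm (y - x0)) + h y"
      by (simp add: h_def power2_eq_square)
    also have "ereal \<dots> \<le> g y"
      using add_right_mono[OF lb[of y], of "ereal (h y)"] by (simp add: g_def)
    finally show ?thesis by simp
  qed
  have "continuous_on UNIV h" unfolding h_def by (intro continuous_intros)
  then have "open {z. c < g z}" for c
    using assms open_superlevel_lsc_plus_continuous[of f h c] by (auto simp: g_def Gamma0_def)
  moreover have gx0: "g x0 = ereal A" by (simp add: g_def a A_def)
  \<comment> \<open>Otherwise \<open>far\<close> would give \<open>A < g x0 = A\<close>.\<close>
  have x0: "x0 \<in> cball x R"
    using far[of x0] by (force simp: gx0 dist_norm norm_minus_commute)
  ultimately obtain p where p: "\<And>y. y \<in> cball x R \<Longrightarrow> g p \<le> g y"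
    using compact_attains_inf_open_superlevel[of "cball x R" g] by (metis compact_cball empty_iff)
  \<comment> \<open>The minimum over the ball is global: outside the ball \<open>g\<close> exceeds
    \<open>A = g x0\<close>, which is at least \<open>g p\<close>.\<close>
  have "g p \<le> g y" for y
  proof (cases "y \<in> cball x R")
    case False
    then have "ereal A < g y" using far[of y] by (simp add: dist_norm norm_minus_commute)
    then show ?thesis using p[OF x0] gx0 by simp
  qed (rule p)
  moreover have "g p \<le> ereal A" using p[OF x0] gx0 by simp
  then have "f p \<noteq> \<infinity>" by (auto simp: g_def)
  then obtain b where "f p = ereal b"
    using lb[of p] by (cases "f p") auto
  ultimately show ?thesis
    by (intro that[of p b]) (auto simp: is_prox_def g_def h_def)
qed

section \<open>Proximal points and subgradients\<close>

lemma econvexD_real: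
  assumes "econvex f" and "t \<in> {0<..<1}" and "f x = ereal a" and "f y = ereal b"
  shows "f (t *\<^sub>R x + (1 - t) *\<^sub>R y) \<le> ereal (t * a + (1 - t) * b)"
proof -
  have "f (t *\<^sub>R x + (1 - t) *\<^sub>R y) \<le> ereal t * f x + ereal (1 - t) * f y"
    using assms(1,2) unfolding econvex_def by blast
  then show ?thesis by (simp add: assms)
qed

lemma subdifferentialD_real:
  assumes "v \<in> subdifferential f x" and "f x = ereal a" and "f y = ereal b"
  shows "a + v \<bullet> (y - x) \<le> b"
proof -
  have "f x + ereal (v \<bullet> (y - x)) \<le> f y"
    using assms(1) by (simp add: subdifferential_def)
  then show ?thesis by (simp add: assms)
qed

text \<open>The first-order optimality condition: compare \<open>p\<close> with a point a fraction
  \<open>s\<close> of the way to \<open>y\<close>, divide by \<open>s\<close> and let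
  \<open>s\<close> tend to 0.\<close>

lemma is_prox_imp_subgradient:
  fixes f :: "'a::real_inner \<Rightarrow> ereal"
  assumes "econvex f" and pr: "is_prox r f x p" and a: "f p = ereal a"
  shows "r *\<^sub>R (x - p) \<in> subdifferential f p"
proof -
  have "f p + ereal (r *\<^sub>R (x - p) \<bullet> (y - p)) \<le> f y" for y
  proof (cases "f y")
    case (real c)
    \<comment> \<open>\<open>q\<close> is the directional derivative of the quadratic term at
      \<open>p\<close> towards \<open>y\<close>, and \<open>D\<close> the coefficient of its
      second-order remainder.\<close>
    define D where "D = r / 2 * (norm (y - p))\<^sup>2"
    define q where "q = r * ((p - x) \<bullet> (y - p))"
    have ineq: "a \<le> c + q + s * D" if s: "s \<in> {0<..<1}" for s
    proof -
      define z where "z = s *\<^sub>R y + (1 - s) *\<^sub>R p"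
      have "ereal (a + r / 2 * (norm (p - x))\<^sup>2) = f p + ereal (r / 2 * (norm (p - x))\<^sup>2)"
        by (simp add: a)
      also have "\<dots> \<le> f z + ereal (r / 2 * (norm (z - x))\<^sup>2)"
        using pr unfolding is_prox_def by blast
      also have "\<dots> \<le> ereal (s * c + (1 - s) * a) + ereal (r / 2 * (norm (z - x))\<^sup>2)"
        unfolding z_def by (intro add_right_mono econvexD_real assms(1) s real a)
      finally have "a + r / 2 * (norm (p - x))\<^sup>2
          \<le> s * c + (1 - s) * a + r / 2 * (norm (z - x))\<^sup>2" by simp
      moreover have "z - x = (p - x) + s *\<^sub>R (y - p)" by (simp add: z_def algebra_simps)
      then have norm_eq: "(norm (z - x))\<^sup>2
          = (norm (p - x))\<^sup>2 + 2 * s * ((p - x) \<bullet> (y - p)) + s\<^sup>2 * (norm (y - p))\<^sup>2"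
        by (simp only: power2_norm_eq_inner inner_add_left inner_add_right inner_scaleR_left
            inner_scaleR_right inner_commute[of "y - p" "p - x"]) (simp add: power2_eq_square distrib_left mult.assoc)
      have "r / 2 * (norm (z - x))\<^sup>2 = r / 2 * (norm (p - x))\<^sup>2 + s * q + s * (s * D)"
        unfolding norm_eq D_def q_def power2_eq_square[of s] by (simp add: distrib_left)
      ultimately have "a \<le> s * c + (1 - s) * a + s * q + s * (s * D)" by linarith
      then have "s * a \<le> s * (c + q + s * D)" by (simp add: algebra_simps)
      then show ?thesis using s by simp
    qed
    have "((\<lambda>s. c + q + s * D) \<longlongrightarrow> c + q + 0 * D) (at_right 0)"
      by (intro tendsto_intros)
    moreover have "eventually (\<lambda>s::real. a \<le> c + q + s * D) (at_right 0)"
      unfolding eventually_at_right_field using ineq by (intro exI[of _ 1]) auto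
    ultimately have "a \<le> c + q"
      using tendsto_lowerbound[of "\<lambda>s. c + q + s * D" "c + q" "at_right 0" a] by simp
    then show ?thesis by (simp add: a real q_def inner_diff_left algebra_simps)
  next
    case MInf
    \<comment> \<open>The value \<open>-\<infinity>\<close> at \<open>y\<close> contradicts
      minimality at \<open>p\<close>, where the objective is real.\<close>
    have "f p + ereal (r / 2 * (norm (p - x))\<^sup>2) \<le> f y + ereal (r / 2 * (norm (y - x))\<^sup>2)"
      using pr by (simp add: is_prox_def)
    then show ?thesis by (simp add: MInf a)
  qed simp
  then show ?thesis by (simp add: subdifferential_def)
qed

text \<open>Expanding the square around \<open>p\<close> produces a linear term that the subgradient
  inequality compensates, and what remains, \<open>r / 2 * (norm (y - p))\<^sup>2\<close>, is
  nonnegative.\<close>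

lemma subgradient_imp_is_prox:
  fixes f :: "'a::real_inner \<Rightarrow> ereal"
  assumes v: "v \<in> subdifferential f p" and "r > 0"
  shows "is_prox r f (p + (1 / r) *\<^sub>R v) p"
  unfolding is_prox_def
proof
  fix y
  let ?x = "p + (1 / r) *\<^sub>R v"
  have "r / 2 * (norm (d - (1 / r) *\<^sub>R v))\<^sup>2
      = r / 2 * (norm d)\<^sup>2 - v \<bullet> d + r / 2 * (norm ((1 / r) *\<^sub>R v))\<^sup>2" for d
    unfolding power2_norm_eq_inner using assms(2)
    by (simp add: inner_diff_left inner_diff_right inner_commute[of d v] field_simps)
  from this[of "y - p"]
  have "r / 2 * (norm (y - ?x))\<^sup>2 = r / 2 * (norm (y - p))\<^sup>2 - v \<bullet> (y - p) + r / 2 * (norm (p - ?x))\<^sup>2"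
    by (simp add: diff_diff_eq)
  moreover have "0 \<le> r / 2 * (norm (y - p))\<^sup>2" using assms(2) by simp
  ultimately have "r / 2 * (norm (p - ?x))\<^sup>2 \<le> v \<bullet> (y - p) + r / 2 * (norm (y - ?x))\<^sup>2"
    by linarith
  \<comment> \<open>No finiteness of \<open>f p\<close> is assumed, so the real inequality is added
    to \<open>f p\<close> within \<open>ereal\<close>.\<close>
  then have "f p + ereal (r / 2 * (norm (p - ?x))\<^sup>2)
      \<le> f p + (ereal (v \<bullet> (y - p)) + ereal (r / 2 * (norm (y - ?x))\<^sup>2))"
    by (intro add_left_mono) simp
  also have "\<dots> = (f p + ereal (v \<bullet> (y - p))) + ereal (r / 2 * (norm (y - ?x))\<^sup>2)"
    by (simp add: add.assoc)
  also have "\<dots> \<le> f y + ereal (r / 2 * (norm (y - ?x))\<^sup>2)"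
    using v by (intro add_right_mono) (simp add: subdifferential_def)
  finally show "f p + ereal (r / 2 * (norm (p - ?x))\<^sup>2) \<le> f y + ereal (r / 2 * (norm (y - ?x))\<^sup>2)" .
qed

text \<open>The affine minorant of slope \<open>v\<close> through \<open>p\<close> also touches
  \<open>f\<close> at \<open>m\<close>, so it supports \<open>f\<close> there too.\<close>

lemma subgradient_transfer:
  assumes v: "v \<in> subdifferential f p" and a: "f p = ereal a"
    and le: "f m \<le> ereal (a + v \<bullet> (m - p))"
  shows "v \<in> subdifferential f m"
proof -
  have "f m + ereal (v \<bullet> (y - m)) \<le> f y" for y
  proof -
    have "f m + ereal (v \<bullet> (y - m)) \<le> ereal (a + v \<bullet> (m - p)) + ereal (v \<bullet> (y - m))"
      using le by (rule add_right_mono)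
    also have "\<dots> = f p + ereal (v \<bullet> (y - p))" by (simp add: a inner_diff_right)
    also have "\<dots> \<le> f y" using v by (simp add: subdifferential_def)
    finally show ?thesis .
  qed
  then show ?thesis by (simp add: subdifferential_def)
qed

text \<open>Convexity puts \<open>f\<close> below the chord. The subgradient at \<open>q\<close>
  puts the chord below the affine minorant at \<open>p\<close>, so that minorant is touched at the
  combination as well.\<close>

lemma common_subgradient_convex_combination:
  assumes "econvex f" and t: "t \<in> {0<..<1}"
    and p: "v \<in> subdifferential f p" and q: "v \<in> subdifferential f q"
    and a: "f p = ereal a" and b: "f q = ereal b"
  shows "v \<in> subdifferential f (t *\<^sub>R p + (1 - t) *\<^sub>R q)"
proof -
  let ?m = "t *\<^sub>R p + (1 - t) *\<^sub>R q"
  have "b + v \<bullet> (p - q) \<le> a"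
    by (rule subdifferentialD_real[OF q b a])
  then have "t * a + (1 - t) * b \<le> t * a + (1 - t) * (a - v \<bullet> (p - q))"
    using t by (intro add_left_mono mult_left_mono) auto
  also have "\<dots> = a + v \<bullet> (?m - p)"
    by (simp add: inner_diff_right inner_add_right algebra_simps)
  finally have 1: "t * a + (1 - t) * b \<le> a + v \<bullet> (?m - p)" .
  have "f ?m \<le> ereal (t * a + (1 - t) * b)"
    by (rule econvexD_real[OF assms(1) t a b])
  also have "\<dots> \<le> ereal (a + v \<bullet> (?m - p))" using 1 by simp
  finally show ?thesis by (rule subgradient_transfer[OF p a])
qed

lemma proper_finite_at_subgradient:
  fixes f :: "'a::real_inner \<Rightarrow> ereal"
  assumes "proper f" and "v \<in> subdifferential f p"
  obtains a where "f p = ereal a"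
proof -
  obtain x0 where "f x0 < \<infinity>" using assms(1) by (auto simp: proper_def edom_def)
  moreover have "f p + ereal (v \<bullet> (x0 - p)) \<le> f x0"
    using assms(2) by (simp add: subdifferential_def)
  ultimately have "f p \<noteq> \<infinity>" by auto
  moreover have "f p \<noteq> -\<infinity>" using assms(1) by (simp add: proper_def)
  ultimately show ?thesis using that by (cases "f p") auto
qed

text \<open>The exact convexity defect of the squared norm; its last term is what forces equal
  displacements to the proximal points.\<close>

lemma norm_sq_convex_combination:
  fixes u w :: "'a::real_inner"
  shows "(norm (t *\<^sub>R u + (1 - t) *\<^sub>R w))\<^sup>2
    = t * (norm u)\<^sup>2 + (1 - t) * (norm w)\<^sup>2 - t * (1 - t) * (norm (u - w))\<^sup>2"
  unfolding power2_norm_eq_inner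
  by (simp add: inner_add_left inner_add_right inner_diff_left inner_diff_right
      inner_commute[of w u] algebra_simps)

section \<open>The two implications\<close>

text \<open>Any set \<open>S\<close> is allowed because a proximal point with finite value exists at
  every point, which makes the envelope real-valued everywhere.\<close>

lemma essentially_strictly_convex_imp_envelope:
  fixes f :: "'a::euclidean_space \<Rightarrow> ereal"
  assumes f: "f \<in> Gamma0" and r: "r > 0" and ess: "essentially_strictly_convex f"
  shows "strictly_convex_on S (moreau_envelope r f)"
  unfolding strictly_convex_on_def
proof (intro ballI impI, rule ccontr)
  fix x y :: 'a and t
  assume xy: "x \<noteq> y" and t: "t \<in> {0<..<1::real}"
  define z where "z = t *\<^sub>R x + (1 - t) *\<^sub>R y"
  assume "\<not> moreau_envelope r f (t *\<^sub>R x + (1 - t) *\<^sub>R y)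
      < ereal t * moreau_envelope r f x + ereal (1 - t) * moreau_envelope r f y"
  then have ge: "ereal t * moreau_envelope r f x + ereal (1 - t) * moreau_envelope r f y
      \<le> moreau_envelope r f z"
    by (simp add: z_def)
  have cvx: "econvex f" using f by (simp add: Gamma0_def)
  obtain p a where p: "is_prox r f x p" and a: "f p = ereal a"
    using is_prox_exists[OF f r] .
  obtain q b where q: "is_prox r f y q" and b: "f q = ereal b"
    using is_prox_exists[OF f r] .
  define m where "m = t *\<^sub>R p + (1 - t) *\<^sub>R q"
  define u where "u = p - x"
  define w where "w = q - y"
  have m_le: "f m \<le> ereal (t * a + (1 - t) * b)"
    unfolding m_def by (rule econvexD_real[OF cvx t a b])
  have mz: "m - z = t *\<^sub>R u + (1 - t) *\<^sub>R w"
    by (simp add: m_def z_def u_def w_def algebra_simps)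
  let ?d = "r / 2 * (t * (1 - t) * (norm (u - w))\<^sup>2)"
  have "ereal (t * (a + r / 2 * (norm u)\<^sup>2) + (1 - t) * (b + r / 2 * (norm w)\<^sup>2))
      \<le> moreau_envelope r f z"
    using ge by (simp add: moreau_envelope_eq[OF p] moreau_envelope_eq[OF q] a b u_def w_def)
  \<comment> \<open>The combination \<open>m\<close> of the proximal points serves as a competitor
    in the infimum at \<open>z\<close>.\<close>
  also have "\<dots> \<le> f m + ereal (r / 2 * (norm (m - z))\<^sup>2)"
    unfolding moreau_envelope_def by (rule INF_lower) simp
  finally have "ereal (t * (a + r / 2 * (norm u)\<^sup>2) + (1 - t) * (b + r / 2 * (norm w)\<^sup>2))
      \<le> f m + ereal (r / 2 * (norm (m - z))\<^sup>2)" .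
  moreover have "r / 2 * (norm (m - z))\<^sup>2 = t * (r / 2 * (norm u)\<^sup>2) + (1 - t) * (r / 2 * (norm w)\<^sup>2) - ?d"
    unfolding mz norm_sq_convex_combination by (simp add: field_simps)
  ultimately have key: "ereal (t * a + (1 - t) * b + ?d) \<le> f m"
    by (cases "f m") (auto simp: algebra_simps)
  \<comment> \<open>\<open>f m\<close> is at least the chord value plus the defect \<open>?d\<close>
    and, by convexity, at most the chord value. Hence \<open>?d\<close> vanishes and the
    displacements \<open>u\<close> and \<open>w\<close> agree.\<close>
  have "ereal (t * a + (1 - t) * b + ?d) \<le> ereal (t * a + (1 - t) * b)"
    using key m_le by (rule order_trans)
  then have "?d \<le> 0" by simp
  then have uw: "u = w"
    using r t by (simp add: mult_le_0_iff)
  then have "p \<noteq> q" using xy by (auto simp: u_def w_def)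
  define v where "v = r *\<^sub>R (x - p)"
  have vp: "v \<in> subdifferential f p"
    unfolding v_def by (rule is_prox_imp_subgradient[OF cvx p a])
  have "x - p = y - q" using uw by (simp add: u_def w_def algebra_simps)
  then have vq: "v \<in> subdifferential f q"
    unfolding v_def using is_prox_imp_subgradient[OF cvx q b] by simp
  \<comment> \<open>The segment is a convex set on which \<open>v\<close> is a subgradient
    throughout, so essential strict convexity applies to it; the endpoints are treated apart from
    the open segment.\<close>
  have "closed_segment q p \<subseteq> dom_subdifferential f"
  proof
    fix s assume "s \<in> closed_segment q p"
    then obtain l where l: "0 \<le> l" "l \<le> 1" "s = (1 - l) *\<^sub>R q + l *\<^sub>R p"
      by (auto simp: closed_segment_def)
    then have s: "s = l *\<^sub>R p + (1 - l) *\<^sub>R q" by (simp add: add.commute)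
    consider "l = 0" | "l = 1" | "l \<in> {0<..<1}" using l by force
    then have "v \<in> subdifferential f s"
      by cases (use s vp vq common_subgradient_convex_combination[OF cvx _ vp vq a b, of l] in auto)
    then show "s \<in> dom_subdifferential f" by (auto simp: dom_subdifferential_def)
  qed
  then have "strictly_convex_on (closed_segment q p) f"
    using ess by (simp add: essentially_strictly_convex_def)
  then have "f m < ereal t * f p + ereal (1 - t) * f q"
    unfolding strictly_convex_on_def m_def using \<open>p \<noteq> q\<close> t by simp
  \<comment> \<open>With \<open>u = w\<close> the term \<open>?d\<close> is 0, so \<open>key\<close>
    says that \<open>f m\<close> is at least the chord value.\<close>
  then show False
    using key uw by (simp add: a b)
qed

lemma envelope_imp_essentially_strictly_convex:
  fixes f :: "'a::euclidean_space \<Rightarrow> ereal"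
  assumes f: "f \<in> Gamma0" and r: "r > 0" and sc: "strictly_convex (moreau_envelope r f)"
  shows "essentially_strictly_convex f"
  unfolding essentially_strictly_convex_def strictly_convex_on_def
proof (intro allI impI ballI, rule ccontr)
  fix C p q t
  assume C: "convex C \<and> C \<subseteq> dom_subdifferential f" and pq: "p \<in> C" "q \<in> C" "p \<noteq> q"
    and t: "t \<in> {0<..<1::real}"
  define m where "m = t *\<^sub>R p + (1 - t) *\<^sub>R q"
  assume "\<not> f (t *\<^sub>R p + (1 - t) *\<^sub>R q) < ereal t * f p + ereal (1 - t) * f q"
  then have ge: "ereal t * f p + ereal (1 - t) * f q \<le> f m" by (simp add: m_def)
  have pf: "proper f" using f by (simp add: Gamma0_def)
  \<comment> \<open>Convexity of \<open>C\<close> is what provides a subgradient at the inner point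
    \<open>m\<close>.\<close>
  have "m \<in> C" using C pq t by (auto simp: m_def intro!: convexD)
  then obtain v where v: "v \<in> subdifferential f m"
    using C unfolding dom_subdifferential_def by blast
  have fin: "\<exists>a. f s = ereal a" if s: "s \<in> C" for s
  proof -
    obtain w where "w \<in> subdifferential f s"
      using C s unfolding dom_subdifferential_def by blast
    then show ?thesis using proper_finite_at_subgradient[OF pf] by blast
  qed
  obtain c where c: "f m = ereal c" using fin \<open>m \<in> C\<close> by blast
  obtain a where a: "f p = ereal a"
    using fin pq by blast
  obtain b where b: "f q = ereal b"
    using fin pq by blast
  have le: "t * a + (1 - t) * b \<le> c" using ge by (simp add: a b c)
  have va: "c + v \<bullet> (p - m) \<le> a" and vb: "c + v \<bullet> (q - m) \<le> b"
    by (rule subdifferentialD_real[OF v c a], rule subdifferentialD_real[OF v c b])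
  have zero: "t * (v \<bullet> (p - m)) + (1 - t) * (v \<bullet> (q - m)) = 0"
    by (simp add: m_def inner_diff_right inner_add_right algebra_simps)
  \<comment> \<open>The weighted subgradient inequalities add up to
    \<open>c \<le> t * a + (1 - t) * b\<close>. Since \<open>le\<close> is the reverse inequality,
    each of them is an equality, so the minorant at \<open>m\<close> touches \<open>f\<close> at
    \<open>p\<close> and \<open>q\<close>.\<close>
  have "t * (c + v \<bullet> (p - m)) \<le> t * a" "(1 - t) * (c + v \<bullet> (q - m)) \<le> (1 - t) * b"
    using va vb t by (simp_all add: mult_left_mono)
  moreover have "t * (c + v \<bullet> (p - m)) + (1 - t) * (c + v \<bullet> (q - m)) = c"
    using zero by (simp add: algebra_simps)
  ultimately have "t * a \<le> t * (c + v \<bullet> (p - m))" "(1 - t) * b \<le> (1 - t) * (c + v \<bullet> (q - m))"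
    using le by linarith+
  then have "a \<le> c + v \<bullet> (p - m)" "b \<le> c + v \<bullet> (q - m)" using t by simp_all
  then have vp: "v \<in> subdifferential f p" and vq: "v \<in> subdifferential f q"
    using subgradient_transfer[OF v c] a b by simp_all
  define x where "x = p + (1 / r) *\<^sub>R v"
  define y where "y = q + (1 / r) *\<^sub>R v"
  have z: "m + (1 / r) *\<^sub>R v = t *\<^sub>R x + (1 - t) *\<^sub>R y"
    by (simp add: m_def x_def y_def algebra_simps del: scaleR_scaleR)
  let ?k = "r / 2 * (norm ((1 / r) *\<^sub>R v))\<^sup>2"
  \<comment> \<open>At the three translated points the envelope is \<open>f\<close> plus the same
    constant \<open>?k\<close>, so the failure of strictness carries over unchanged.\<close>
  have env: "moreau_envelope r f (s + (1 / r) *\<^sub>R v) = f s + ereal ?k"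
    if "v \<in> subdifferential f s" for s
    using moreau_envelope_eq[OF subgradient_imp_is_prox[OF that r]] by simp
  have ex: "moreau_envelope r f x = ereal (a + ?k)" and ey: "moreau_envelope r f y = ereal (b + ?k)"
    using env[OF vp] env[OF vq] by (simp_all add: x_def y_def a b)
  have ez: "moreau_envelope r f (t *\<^sub>R x + (1 - t) *\<^sub>R y) = ereal (c + ?k)"
    using env[OF v] by (simp add: z c)
  have "x \<in> edom (moreau_envelope r f)" "y \<in> edom (moreau_envelope r f)"
    unfolding edom_def mem_Collect_eq ex ey by simp_all
  moreover have "x \<noteq> y" using pq by (simp add: x_def y_def)
  ultimately have "moreau_envelope r f (t *\<^sub>R x + (1 - t) *\<^sub>R y)
      < ereal t * moreau_envelope r f x + ereal (1 - t) * moreau_envelope r f y"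
    using sc t unfolding strictly_convex_def strictly_convex_on_def by blast
  then have "ereal (c + ?k) < ereal t * ereal (a + ?k) + ereal (1 - t) * ereal (b + ?k)"
    unfolding ex ey ez .
  then have "c + ?k < t * (a + ?k) + (1 - t) * (b + ?k)" by simp
  \<comment> \<open>The weights sum to 1, so the common offset cancels against the one on the
    left.\<close>
  also have "t * (a + k) + (1 - t) * (b + k) = t * a + (1 - t) * b + k" for k
    by (simp add: algebra_simps)
  finally show False using le by simp
qed

theorem theorem3p7:
  fixes f :: "real ^ 'n \<Rightarrow> ereal" and r :: real
  assumes "f \<in> Gamma0" and "r > 0"
  shows "essentially_strictly_convex f \<longleftrightarrow> strictly_convex (moreau_envelope r f)"
  using essentially_strictly_convex_imp_envelope[OF assms]
    envelope_imp_essentially_strictly_convex[OF assms]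
  by (auto simp: strictly_convex_def)

end
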